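(* Let $m\ge 1$ and let $(G_i,X_i)_{i\ge 1}$ be a sequence in the space of marked groups $\mathcal{G}_m$ converging to $(G,X)\in\mathcal{G}_m$, where $G$ is finitely presented. For each $i$ let $\Gamma_i=\langle X_i\mid R_i\rangle$ be an arbitrary presentation of $G_i$ (with $R_i$ possibly infinite) and let $\delta_i$ be the Dehn function of $G_i$ corresponding to $\Gamma_i$. Let $\Gamma=\langle X\mid R\rangle$ be any finite presentation of $G$ and let $L=\max_{r\in R}\|r\|$. If the set $\{\delta_i(L): i\ge 1\}$ is finite, then the set $\{\delta_i(n): i\ge 1\}$ is finite for every integer $n\ge 0$.
   Context: A marked group $(G,X)$ consists of a group $G$ and an $m$-tuple $X=(x_1,\dots,x_m)$ of elements generating $G$. Two marked groups $(G,X)$ and $(G',X')$ are identified if there is an isomorphism $G\to G'$ sending $x_j$ to $x'_j$ for every $j$; $\mathcal{G}_m$ is the set of all marked groups with $m$ generators up to this identification. Let $\mathbb{F}$ be the free group on $m$ letters, with word length $\|\cdot\|$; through the correspondence of the $j$-th free letter with the $j$-th entry of the marking, $\mathbb{F}$ is identified with $F(X)$ and with $F(X_i)$ for every $i$. For $w\in\mathbb{F}$, $w_G$ denotes the image of $w$ in $G$ under the marking. Put $\mathrm{Rel}_\lambda(G,X)=\{w\in\mathbb{F}:\|w\|\le\lambda,\ w_G=1\}$ for integers $\lambda\ge 0$. The Gromov-Grigorchuk metric on $\mathcal{G}_m$ is $d((G,X),(G',X'))=e^{-\Lambda}$, where $\Lambda$ is the largest integer with $\mathrm{Rel}_\Lambda(G,X)=\mathrm{Rel}_\Lambda(G',X')$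 (and $d=0$ if equality holds for all integers). Thus $(G_i,X_i)\to(G,X)$ means that for every $\lambda$ one has $\mathrm{Rel}_\lambda(G_i,X_i)=\mathrm{Rel}_\lambda(G,X)$ for all sufficiently large $i$. A presentation $\langle X\mid R\rangle$ of a marked group $(G,X)$ is a subset $R\subseteq\mathbb{F}$ whose normal closure in $\mathbb{F}$ is $\{w\in\mathbb{F}: w_G=1\}$; it is finite if $R$ is finite. For $w\in\mathbb{F}$ with $w_G=1$, $\mathrm{Area}_R(w)$ is the smallest $k\ge 0$ such that $w=\prod_{j=1}^k u_jr_j^{\pm1}u_j^{-1}$ in $\mathbb{F}$ for some $u_1,\dots,u_k\in\mathbb{F}$ and $r_1,\dots,r_k\in R$ (so the area of the trivial word is $0$). The Dehn function corresponding to $\langle X\mid R\rangle$ is $\delta(n)=\max\{\mathrm{Area}_R(w): w\in\mathbb{F},\ w_G=1,\ \|w\|\le n\}$. Convention: $L=0$ if $R=\emptyset$. *)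

theory Defs
  imports Complex_Main "HOL-Algebra.Generated_Groups"
begin

section \<open>The free group on \<open>m\<close> letters, as reduced words\<close>

(* (j, True) is the j-th free letter (0 \<le> j < m) and (j, False) is its inverse. *)
type_synonym letter = "nat \<times> bool"

definition inv_letter :: "letter \<Rightarrow> letter" where
  "inv_letter x = (fst x, \<not> snd x)"

definition reduced :: "letter list \<Rightarrow> bool" where
  "reduced w \<longleftrightarrow> successively (\<lambda>x y. y \<noteq> inv_letter x) w"

fun push :: "letter \<Rightarrow> letter list \<Rightarrow> letter list" where
  "push x [] = [x]"
| "push x (y # w) = (if y = inv_letter x then w else x # y # w)"

(* Free reduction. *)
definition reduce :: "letter list \<Rightarrow> letter list" where
  "reduce w = foldr push w []"

(* The word length of an element is its length as a list. *)
definition free_group :: "nat \<Rightarrow> letter list monoid" where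
  "free_group m =
     \<lparr>carrier = {w. fst ` set w \<subseteq> {..<m} \<and> reduced w},
      monoid.mult = (\<lambda>u v. reduce (u @ v)),
      monoid.one = []\<rparr>"

lemma inv_letter_inv_letter [simp]: "inv_letter (inv_letter x) = x"
  by (simp add: inv_letter_def)

lemma fst_inv_letter [simp]: "fst (inv_letter x) = fst x"
  by (simp add: inv_letter_def)

lemma reduced_push: "reduced w \<Longrightarrow> reduced (push x w)"
  by (cases w) (auto simp: reduced_def successively_Cons split: if_splits)

lemma reduced_foldr_push: "reduced w \<Longrightarrow> reduced (foldr push u w)"
  by (induction u) (auto simp: reduced_push)

lemma reduced_reduce: "reduced (reduce w)"
  unfolding reduce_def by (rule reduced_foldr_push) (simp add: reduced_def)

lemma reduce_reduced: "reduced w \<Longrightarrow> reduce w = w"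
proof (induction w)
  case Nil
  show ?case by (simp add: reduce_def)
next
  case (Cons x w)
  then have "reduce w = w"
    by (auto simp: reduced_def successively_Cons)
  with Cons.prems show ?case
    by (cases w) (auto simp: reduce_def reduced_def)
qed

lemma push_push_inv: "reduced w \<Longrightarrow> push x (push (inv_letter x) w) = w"
  by (cases w; cases "tl w") (auto simp: reduced_def)

lemma foldr_push_push:
  "reduced w \<Longrightarrow> foldr push (push x u) w = push x (foldr push u w)"
proof (cases u)
  case (Cons y v)
  assume "reduced w"
  then have "push x (push (inv_letter x) (foldr push v w)) = foldr push v w"
    by (intro push_push_inv reduced_foldr_push)
  with Cons show ?thesis by simp
qed simp

lemma foldr_push_reduce:
  "reduced w \<Longrightarrow> foldr push (reduce u) w = foldr push u w"
  by (induction u) (simp_all add: reduce_def foldr_push_push)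

lemma reduce_append_left: "reduce (reduce u @ v) = reduce (u @ v)"
  using foldr_push_reduce[of "reduce v" u] reduced_reduce[of v]
  by (simp add: reduce_def)

lemma reduce_append_right: "reduce (u @ reduce v) = reduce (u @ v)"
  using reduce_reduced[OF reduced_reduce[of v]] by (simp add: reduce_def)

lemma set_push: "set (push x w) \<subseteq> insert x (set w)"
  by (cases w) auto

lemma set_reduce: "set (reduce w) \<subseteq> set w"
proof (induction w)
  case (Cons x w)
  then show ?case using set_push[of x "reduce w"] by (auto simp: reduce_def)
qed (simp add: reduce_def)

lemma letters_reduce: "fst ` set w \<subseteq> A \<Longrightarrow> fst ` set (reduce w) \<subseteq> A"
  using set_reduce[of w] by (meson image_mono order_trans)

lemma reduce_inverse: "reduce (map inv_letter (rev w) @ w) = []"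
proof (induction w)
  case (Cons x w)
  have "push (inv_letter x) (push x (reduce w)) = reduce w"
    using push_push_inv[of "reduce w" "inv_letter x"] reduced_reduce by simp
  then have "reduce (map inv_letter (rev (x # w)) @ x # w) =
      reduce (map inv_letter (rev w) @ reduce w)"
    using reduce_reduced[OF reduced_reduce[of w]] by (simp add: reduce_def)
  then show ?case using Cons by (simp add: reduce_append_right)
qed (simp add: reduce_def)

lemma group_free_group: "group (free_group m)"
proof (rule groupI)
  fix u v w
  assume u: "u \<in> carrier (free_group m)" and v: "v \<in> carrier (free_group m)"
  then show "u \<otimes>\<^bsub>free_group m\<^esub> v \<in> carrier (free_group m)"
    using letters_reduce[of "u @ v" "{..<m}"]
    by (simp add: free_group_def reduced_reduce image_Un)
  show "u \<otimes>\<^bsub>free_group m\<^esub> v \<otimes>\<^bsub>free_group m\<^esub> w =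
      u \<otimes>\<^bsub>free_group m\<^esub> (v \<otimes>\<^bsub>free_group m\<^esub> w)"
    by (simp add: free_group_def reduce_append_left reduce_append_right)
next
  show "\<one>\<^bsub>free_group m\<^esub> \<in> carrier (free_group m)"
    by (simp add: free_group_def reduced_def)
next
  fix w assume w: "w \<in> carrier (free_group m)"
  then show "\<one>\<^bsub>free_group m\<^esub> \<otimes>\<^bsub>free_group m\<^esub> w = w"
    by (simp add: free_group_def reduce_reduced)
  let ?v = "reduce (map inv_letter (rev w))"
  have "?v \<in> carrier (free_group m)"
    using w letters_reduce[of "map inv_letter (rev w)" "{..<m}"]
    by (simp add: free_group_def reduced_reduce image_image)
  moreover have "?v \<otimes>\<^bsub>free_group m\<^esub> w = \<one>\<^bsub>free_group m\<^esub>"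
    by (simp add: free_group_def reduce_append_left reduce_inverse)
  ultimately show "\<exists>v\<in>carrier (free_group m). v \<otimes>\<^bsub>free_group m\<^esub> w = \<one>\<^bsub>free_group m\<^esub>"
    by blast
qed

section \<open>Marked groups\<close>

definition marked_group :: "nat \<Rightarrow> ('a, 'b) monoid_scheme \<Rightarrow> 'a list \<Rightarrow> bool" where
  "marked_group m G X \<longleftrightarrow>
     group G \<and> length X = m \<and> set X \<subseteq> carrier G \<and> generate G (set X) = carrier G"

(* The image of a word w in G under the marking X. *)
definition word_eval :: "('a, 'b) monoid_scheme \<Rightarrow> 'a list \<Rightarrow> letter list \<Rightarrow> 'a" where
  "word_eval G X w =
     foldr (\<lambda>(j, b) g. (if b then X ! j else inv\<^bsub>G\<^esub> (X ! j)) \<otimes>\<^bsub>G\<^esub> g) w \<one>\<^bsub>G\<^esub>"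

definition Rel :: "nat \<Rightarrow> ('a, 'b) monoid_scheme \<Rightarrow> 'a list \<Rightarrow> nat \<Rightarrow> letter list set" where
  "Rel m G X n = {w \<in> carrier (free_group m). length w \<le> n \<and> word_eval G X w = \<one>\<^bsub>G\<^esub>}"

(* The Gromov-Grigorchuk metric, computed on representatives (G, X) of points of the
   space of marked groups; Rel, and with it everything below, depends only on the
   isomorphism class of the marked group. *)
definition mg_dist ::
  "nat \<Rightarrow> ('a, 'c) monoid_scheme \<Rightarrow> 'a list \<Rightarrow> ('b, 'd) monoid_scheme \<Rightarrow> 'b list \<Rightarrow> real" where
  "mg_dist m G X H Y =
     (if \<forall>n. Rel m G X n = Rel m H Y n then 0
      else exp (- real (GREATEST n. Rel m G X n = Rel m H Y n)))"

lemma word_eval_hom: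
  assumes "marked_group m G X"
  shows "word_eval G X \<in> hom (free_group m) G"
proof -
  interpret G: group G using assms by (simp add: marked_group_def)
  have X: "X ! j \<in> carrier G" if "j < m" for j
    using assms that by (auto simp: marked_group_def)
  have closed: "word_eval G X w \<in> carrier G" if "fst ` set w \<subseteq> {..<m}" for w
    using that by (induction w) (auto simp: word_eval_def X)
  have app: "word_eval G X (u @ v) = word_eval G X u \<otimes>\<^bsub>G\<^esub> word_eval G X v"
    if "fst ` set u \<subseteq> {..<m}" "fst ` set v \<subseteq> {..<m}" for u v
    using that
  proof (induction u)
    case Nil
    then show ?case using closed[of v] by (simp add: word_eval_def)
  next
    case (Cons x u)
    then show ?case using closed[of u] closed[of v]
      by (cases x) (auto simp: word_eval_def X G.m_assoc)
  qed
  have push: "word_eval G X (push x w) = word_eval G X (x # w)"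
    if "fst ` set (x # w) \<subseteq> {..<m}" for x w
  proof (cases w)
    case (Cons y v)
    have v: "word_eval G X v \<in> carrier G" using that Cons closed[of v] by auto
    show ?thesis
    proof (cases "y = inv_letter x")
      case True
      have "X ! fst x \<in> carrier G" using that X by auto
      then show ?thesis using True Cons v
        by (cases x) (auto simp: word_eval_def inv_letter_def simp flip: G.m_assoc)
    qed (simp add: Cons)
  qed simp
  have red: "word_eval G X (reduce w) = word_eval G X w" if "fst ` set w \<subseteq> {..<m}" for w
    using that
  proof (induction w)
    case (Cons x w)
    have "fst ` set (x # reduce w) \<subseteq> {..<m}"
      using Cons.prems letters_reduce[of w "{..<m}"] by simp
    from push[OF this] have "word_eval G X (reduce (x # w)) = word_eval G X (x # reduce w)"
      by (simp add: reduce_def)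
    with Cons show ?case by (simp add: word_eval_def)
  qed (simp add: reduce_def)
  show ?thesis
  proof (rule homI)
    fix u v assume "u \<in> carrier (free_group m)" "v \<in> carrier (free_group m)"
    then have "fst ` set u \<subseteq> {..<m}" "fst ` set v \<subseteq> {..<m}"
      by (auto simp: free_group_def)
    then show "word_eval G X u \<in> carrier G"
      "word_eval G X (u \<otimes>\<^bsub>free_group m\<^esub> v) = word_eval G X u \<otimes>\<^bsub>G\<^esub> word_eval G X v"
      using closed app[of u v] red[of "u @ v"] by (auto simp: free_group_def)
  qed
qed

lemma finite_Rel: "finite (Rel m G X n)"
proof (rule finite_subset)
  show "Rel m G X n \<subseteq> {w. set w \<subseteq> {..<m} \<times> UNIV \<and> length w \<le> n}"
    by (force simp: Rel_def free_group_def)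
  show "finite {w :: letter list. set w \<subseteq> {..<m} \<times> UNIV \<and> length w \<le> n}"
    by (rule finite_lists_length_le) simp
qed

lemma Nil_in_Rel: "[] \<in> Rel m G X n"
  by (simp add: Rel_def free_group_def reduced_def word_eval_def)

section \<open>Presentations and Dehn functions\<close>

definition normal_closure :: "('a, 'b) monoid_scheme \<Rightarrow> 'a set \<Rightarrow> 'a set" where
  "normal_closure F R = \<Inter>{N. N \<lhd> F \<and> R \<subseteq> N}"

definition presentation ::
  "nat \<Rightarrow> ('a, 'b) monoid_scheme \<Rightarrow> 'a list \<Rightarrow> letter list set \<Rightarrow> bool" where
  "presentation m G X R \<longleftrightarrow>
     R \<subseteq> carrier (free_group m) \<and>
     normal_closure (free_group m) R = kernel (free_group m) G (word_eval G X)"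

definition conj_prod :: "('a, 'b) monoid_scheme \<Rightarrow> ('a \<times> 'a \<times> int) list \<Rightarrow> 'a" where
  "conj_prod F ps =
     foldr (\<lambda>(u, r, e) g. (u \<otimes>\<^bsub>F\<^esub> (r [^]\<^bsub>F\<^esub> e) \<otimes>\<^bsub>F\<^esub> inv\<^bsub>F\<^esub> u) \<otimes>\<^bsub>F\<^esub> g) ps \<one>\<^bsub>F\<^esub>"

(* Unspecified (LEAST over the empty set) unless w lies in the normal closure of R. *)
definition area :: "('a, 'b) monoid_scheme \<Rightarrow> 'a set \<Rightarrow> 'a \<Rightarrow> nat" where
  "area F R w =
     (LEAST k. \<exists>ps. length ps = k \<and> set ps \<subseteq> carrier F \<times> R \<times> {1, -1} \<and> w = conj_prod F ps)"

definition dehn ::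
  "nat \<Rightarrow> ('a, 'b) monoid_scheme \<Rightarrow> 'a list \<Rightarrow> letter list set \<Rightarrow> nat \<Rightarrow> nat" where
  "dehn m G X R n = Max (area (free_group m) R ` Rel m G X n)"

definition max_length :: "letter list set \<Rightarrow> nat" where
  "max_length R = (if R = {} then 0 else Max (length ` R))"

end

(*
  For large i the marked groups (G, X) and (G_i, X_i) have the same relators of length at most
  max(n, L). Fix for each such relator w of length at most n one expression as a product of k_w
  conjugates of elements of R or their inverses. Each r in R has length at most L, so it is a
  relator of G_i of area at most delta_i(L); substituting, Area_{R_i}(w) is at most
  k_w * delta_i(L), a bound that does not depend on i.
*)
theory Submission
  imports Defs
begin

section \<open>Products of conjugates of relators in an arbitrary group\<close>

definition conj_seqs :: "('a, 'b) monoid_scheme \<Rightarrow> 'a set \<Rightarrow> ('a \<times> 'a \<times> int) list set" where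
  "conj_seqs F R = {ps. set ps \<subseteq> carrier F \<times> R \<times> {1, -1}}"

context group
begin

lemma conj_prod_Nil [simp]: "conj_prod G [] = \<one>"
  by (simp add: conj_prod_def)

lemma conj_prod_Cons [simp]:
  "conj_prod G ((u, r, e) # ps) = (u \<otimes> (r [^] e) \<otimes> inv u) \<otimes> conj_prod G ps"
  by (simp add: conj_prod_def)

lemma conj_prod_closed:
  assumes "R \<subseteq> carrier G" "ps \<in> conj_seqs G R"
  shows "conj_prod G ps \<in> carrier G"
  using assms(2)
proof (induction ps)
  case (Cons p ps)
  then show ?case using assms(1) by (cases p) (auto simp: conj_seqs_def)
qed simp

lemma conj_prod_append:
  assumes "R \<subseteq> carrier G" "ps \<in> conj_seqs G R" "qs \<in> conj_seqs G R"
  shows "conj_prod G (ps @ qs) = conj_prod G ps \<otimes> conj_prod G qs"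
  using assms(2)
proof (induction ps)
  case Nil
  then show ?case using conj_prod_closed[OF assms(1,3)] by simp
next
  case (Cons p ps)
  obtain u r e where p: "p = (u, r, e)" by (cases p)
  have "ps \<in> conj_seqs G R" "u \<in> carrier G" "r \<in> carrier G"
    using Cons.prems assms(1) by (auto simp: conj_seqs_def p)
  then show ?case
    using Cons.IH conj_prod_closed[OF assms(1), of ps] conj_prod_closed[OF assms(1,3)]
    by (simp add: p m_assoc)
qed

lemma inv_conj:
  assumes "u \<in> carrier G" "x \<in> carrier G"
  shows "inv (u \<otimes> x \<otimes> inv u) = u \<otimes> inv x \<otimes> inv u"
  using assms by (simp add: inv_mult_group m_assoc)

lemma conj_mult:
  assumes "g \<in> carrier G" "x \<in> carrier G" "y \<in> carrier G"
  shows "g \<otimes> (x \<otimes> y) \<otimes> inv g = (g \<otimes> x \<otimes> inv g) \<otimes> (g \<otimes> y \<otimes> inv g)"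
proof -
  have "inv g \<otimes> (g \<otimes> z) = z" if "z \<in> carrier G" for z
    using assms that by (simp flip: m_assoc)
  then show ?thesis using assms by (simp add: m_assoc)
qed

text \<open>Inversion reverses the order of the factors, and the inverse of a conjugate of
  \<open>r [^] e\<close> is the conjugate of \<open>r [^] (- e)\<close> by the same element. The
  length is tracked because it becomes the area count.\<close>

lemma conj_prod_inv:
  assumes "R \<subseteq> carrier G" "ps \<in> conj_seqs G R"
  shows "\<exists>qs \<in> conj_seqs G R. length qs = length ps \<and> conj_prod G qs = inv (conj_prod G ps)"
  using assms(2)
proof (induction ps)
  case Nil
  then show ?case by simp
next
  case (Cons p ps)
  obtain u r e where p: "p = (u, r, e)" by (cases p)
  have ps: "ps \<in> conj_seqs G R" and u: "u \<in> carrier G" and r: "r \<in> R" "r \<in> carrier G"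
    and e: "e \<in> {1, -1}"
    using Cons.prems assms(1) by (auto simp: conj_seqs_def p)
  from Cons.IH[OF ps] obtain qs where qs: "qs \<in> conj_seqs G R" "length qs = length ps"
    "conj_prod G qs = inv (conj_prod G ps)" by blast
  let ?q = "[(u, r, - e)]"
  have q: "?q \<in> conj_seqs G R" using u r e by (auto simp: conj_seqs_def)
  have "conj_prod G (qs @ ?q) = inv (conj_prod G ps) \<otimes> inv (u \<otimes> r [^] e \<otimes> inv u)"
    using conj_prod_append[OF assms(1) qs(1) q] u r qs(3)
    by (simp add: int_pow_neg inv_conj)
  also have "\<dots> = inv (conj_prod G (p # ps))"
    using u r conj_prod_closed[OF assms(1) ps] by (simp add: p inv_mult_group)
  finally have "conj_prod G (qs @ ?q) = inv (conj_prod G (p # ps))" .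
  moreover have "qs @ ?q \<in> conj_seqs G R" using qs(1) q by (simp add: conj_seqs_def)
  ultimately show ?case using qs(2) by (intro bexI[of _ "qs @ ?q"]) simp_all
qed

text \<open>Conjugation by \<open>g\<close> distributes over the factors and merely turns each
  conjugator \<open>u\<close> into \<open>g \<otimes> u\<close>, so no factors are added.\<close>

lemma conj_prod_conj:
  assumes "R \<subseteq> carrier G" "ps \<in> conj_seqs G R" "g \<in> carrier G"
  shows "\<exists>qs \<in> conj_seqs G R. length qs = length ps \<and>
    conj_prod G qs = g \<otimes> conj_prod G ps \<otimes> inv g"
  using assms(2)
proof (induction ps)
  case Nil
  then show ?case using assms(3) by simp
next
  case (Cons p ps)
  obtain u r e where p: "p = (u, r, e)" by (cases p)
  have ps: "ps \<in> conj_seqs G R" and u: "u \<in> carrier G" and r: "r \<in> R" "r \<in> carrier G"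
    and e: "e \<in> {1, -1}"
    using Cons.prems assms(1) by (auto simp: conj_seqs_def p)
  from Cons.IH[OF ps] obtain qs where qs: "qs \<in> conj_seqs G R" "length qs = length ps"
    "conj_prod G qs = g \<otimes> conj_prod G ps \<otimes> inv g" by blast
  let ?q = "(g \<otimes> u, r, e)"
  have "conj_prod G (?q # qs) = (g \<otimes> (u \<otimes> r [^] e \<otimes> inv u) \<otimes> inv g) \<otimes> conj_prod G qs"
    using u r assms(3) conj_prod_closed[OF assms(1) qs(1)] by (simp add: m_assoc inv_mult_group)
  also have "\<dots> = g \<otimes> conj_prod G (p # ps) \<otimes> inv g"
    using u r assms(3) conj_prod_closed[OF assms(1) ps] conj_mult by (simp add: p qs(3))
  finally have "conj_prod G (?q # qs) = g \<otimes> conj_prod G (p # ps) \<otimes> inv g" .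
  moreover have "?q # qs \<in> conj_seqs G R" using qs(1) u r e assms(3) by (simp add: conj_seqs_def)
  ultimately show ?case using qs(2) by (intro bexI[of _ "?q # qs"]) simp_all
qed

lemma normal_conj_prods:
  assumes R: "R \<subseteq> carrier G"
  shows "conj_prod G ` conj_seqs G R \<lhd> G"
  unfolding normal_inv_iff
proof (intro conjI ballI)
  show "subgroup (conj_prod G ` conj_seqs G R) G"
  proof (rule subgroupI)
    show "conj_prod G ` conj_seqs G R \<subseteq> carrier G" using conj_prod_closed[OF R] by blast
    show "conj_prod G ` conj_seqs G R \<noteq> {}" by (auto simp: conj_seqs_def intro!: exI[of _ "[]"])
  next
    fix a assume "a \<in> conj_prod G ` conj_seqs G R"
    then show "inv a \<in> conj_prod G ` conj_seqs G R"
      using conj_prod_inv[OF R] by (force simp: image_iff)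
  next
    fix a b assume "a \<in> conj_prod G ` conj_seqs G R" "b \<in> conj_prod G ` conj_seqs G R"
    then obtain ps qs where "ps \<in> conj_seqs G R" "a = conj_prod G ps"
      "qs \<in> conj_seqs G R" "b = conj_prod G qs" by blast
    then show "a \<otimes> b \<in> conj_prod G ` conj_seqs G R"
      using conj_prod_append[OF R] by (intro image_eqI[of _ _ "ps @ qs"]) (auto simp: conj_seqs_def)
  qed
next
  fix g a assume "g \<in> carrier G" "a \<in> conj_prod G ` conj_seqs G R"
  then show "g \<otimes> a \<otimes> inv g \<in> conj_prod G ` conj_seqs G R"
    using conj_prod_conj[OF R] by (force simp: image_iff)
qed

text \<open>The products form one of the normal subgroups being intersected: each \<open>r\<close>
  in \<open>R\<close> is the one-factor product with conjugator \<open>\<one>\<close>.\<close>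

lemma normal_closure_subset_conj_prods:
  assumes R: "R \<subseteq> carrier G"
  shows "normal_closure G R \<subseteq> conj_prod G ` conj_seqs G R"
proof -
  have "r \<in> conj_prod G ` conj_seqs G R" if "r \<in> R" for r
    using that R by (intro image_eqI[of _ _ "[(\<one>, r, 1)]"]) (auto simp: conj_seqs_def)
  then have "R \<subseteq> conj_prod G ` conj_seqs G R" by blast
  then show ?thesis
    using normal_conj_prods[OF R] unfolding normal_closure_def by blast
qed

section \<open>Area and its behaviour under a change of relators\<close>

lemma area_le:
  assumes "ps \<in> conj_seqs G R"
  shows "area G R (conj_prod G ps) \<le> length ps"
  unfolding area_def using assms by (intro Least_le exI[of _ ps]) (simp add: conj_seqs_def)

text \<open>On the normal closure the \<open>LEAST\<close> in \<open>area\<close> ranges over a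
  nonempty set, so it is a genuine minimum and some expression realizes it.\<close>

lemma area_attained:
  assumes "R \<subseteq> carrier G" "w \<in> normal_closure G R"
  obtains ps where "ps \<in> conj_seqs G R" "length ps = area G R w" "conj_prod G ps = w"
proof -
  obtain qs where "qs \<in> conj_seqs G R" "w = conj_prod G qs"
    using normal_closure_subset_conj_prods[OF assms(1)] assms(2) by blast
  then have "\<exists>k ps. length ps = k \<and> set ps \<subseteq> carrier G \<times> R \<times> {1, -1} \<and> w = conj_prod G ps"
    unfolding conj_seqs_def by blast
  from LeastI_ex[OF this] show ?thesis
    using that unfolding area_def conj_seqs_def by blast
qed

text \<open>Substitution: replace each factor by a shortest expression of its relator over
  \<open>S\<close>. Inverting and conjugating that expression preserve its length, so every old
  factor costs at most \<open>D\<close> new ones.\<close>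

lemma conj_prod_change_relators:
  assumes S: "S \<subseteq> carrier G" and R: "R \<subseteq> normal_closure G S"
    and D: "\<And>r. r \<in> R \<Longrightarrow> area G S r \<le> D"
    and ps: "ps \<in> conj_seqs G R"
  shows "\<exists>qs \<in> conj_seqs G S. length qs \<le> length ps * D \<and> conj_prod G qs = conj_prod G ps"
  using ps
proof (induction ps)
  case Nil
  then show ?case by (intro bexI[of _ "[]"]) (auto simp: conj_seqs_def)
next
  case (Cons p ps)
  obtain u r e where p: "p = (u, r, e)" by (cases p)
  have ps: "ps \<in> conj_seqs G R" and u: "u \<in> carrier G" and r: "r \<in> R" and e: "e \<in> {1, -1}"
    using Cons.prems by (auto simp: conj_seqs_def p)
  from Cons.IH[OF ps] obtain qs where qs: "qs \<in> conj_seqs G S" "length qs \<le> length ps * D"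
    "conj_prod G qs = conj_prod G ps" by blast
  obtain ts where ts: "ts \<in> conj_seqs G S" "length ts = area G S r" "conj_prod G ts = r"
    using area_attained[OF S] R r by blast
  have rG: "r \<in> carrier G" using conj_prod_closed[OF S ts(1)] ts(3) by simp
  \<comment> \<open>The exponent is absorbed first: \<open>ts\<close> itself serves for 1, and its
    inverse product for -1.\<close>
  have "\<exists>vs \<in> conj_seqs G S. length vs = length ts \<and> conj_prod G vs = r [^] e"
  proof (cases "e = 1")
    case True
    then show ?thesis using ts rG by auto
  next
    case False
    then have "r [^] e = inv r" using e rG by (simp add: int_pow_neg)
    then show ?thesis using conj_prod_inv[OF S ts(1)] ts(3) by simp
  qed
  then obtain vs where vs: "vs \<in> conj_seqs G S" "length vs = length ts" "conj_prod G vs = r [^] e"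
    by blast
  obtain us where us: "us \<in> conj_seqs G S" "length us = length vs"
    "conj_prod G us = u \<otimes> r [^] e \<otimes> inv u"
    using conj_prod_conj[OF S vs(1) u] vs(3) by auto
  have "conj_prod G (us @ qs) = conj_prod G (p # ps)"
    using conj_prod_append[OF S us(1) qs(1)] by (simp add: us qs p)
  moreover have "us @ qs \<in> conj_seqs G S" using us qs by (simp add: conj_seqs_def)
  moreover have "length (us @ qs) \<le> length (p # ps) * D"
    using qs(2) D[OF r] by (simp add: us vs ts)
  ultimately show ?case by blast
qed

lemma area_change_relators:
  assumes S: "S \<subseteq> carrier G" and R: "R \<subseteq> carrier G" "R \<subseteq> normal_closure G S"
    and D: "\<And>r. r \<in> R \<Longrightarrow> area G S r \<le> D"
    and w: "w \<in> normal_closure G R"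
  shows "area G S w \<le> area G R w * D"
proof -
  obtain ps where ps: "ps \<in> conj_seqs G R" "length ps = area G R w" "conj_prod G ps = w"
    using area_attained[OF R(1) w] .
  obtain qs where "qs \<in> conj_seqs G S" "length qs \<le> length ps * D" "conj_prod G qs = w"
    using conj_prod_change_relators[OF S R(2) D ps(1)] ps(3) by auto
  then show ?thesis using area_le[of qs S] ps(2) by simp
qed

end

section \<open>Relators of bounded length, the metric and Dehn functions\<close>

lemma presentation_kernel_iff:
  assumes "presentation m G X R"
  shows "w \<in> normal_closure (free_group m) R \<longleftrightarrow>
    w \<in> carrier (free_group m) \<and> word_eval G X w = \<one>\<^bsub>G\<^esub>"
  using assms by (simp add: presentation_def kernel_def)

lemma area_le_dehn:
  assumes "w \<in> Rel m G X n"
  shows "area (free_group m) R w \<le> dehn m G X R n"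
  unfolding dehn_def using assms by (intro Max_ge) (auto simp: finite_Rel)

lemma Rel_restrict:
  assumes "k \<le> n"
  shows "Rel m G X k = {w \<in> Rel m G X n. length w \<le> k}"
  using assms by (auto simp: Rel_def)

text \<open>Relators of length at most \<open>k\<close> are cut out of those of length at most
  \<open>n\<close> by length alone. Hence the levels of agreement form an initial segment of the
  naturals.\<close>

lemma Rel_eq_antimono:
  assumes "Rel m G X n = Rel m H Y n" "k \<le> n"
  shows "Rel m G X k = Rel m H Y k"
  using assms by (simp add: Rel_restrict[of k n])

lemma Rel_eq_of_mg_dist_less:
  assumes "mg_dist m G X H Y < exp (- real n)"
  shows "Rel m G X n = Rel m H Y n"
proof (cases "\<forall>k. Rel m G X k = Rel m H Y k")
  case False
  then obtain N where N: "Rel m G X N \<noteq> Rel m H Y N" by blast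
  let ?P = "\<lambda>k. Rel m G X k = Rel m H Y k"
  \<comment> \<open>The \<open>GREATEST\<close> in the metric is meaningful only for a nonempty
    bounded set of levels. Level 0 belongs to it, as only the empty word has length 0; the
    disagreement at \<open>N\<close> bounds it.\<close>
  have "?P 0" by (auto simp: Rel_def word_eval_def)
  moreover have "k \<le> N" if "?P k" for k
    using N Rel_eq_antimono[OF that, of N] by (rule contrapos_np) simp
  ultimately have "?P (Greatest ?P)" using GreatestI_nat[of ?P 0 N] by blast
  moreover have "n \<le> Greatest ?P" using assms False by (simp add: mg_dist_def)
  ultimately show ?thesis using Rel_eq_antimono by blast
qed blast

text \<open>The two agreements play different roles: the one at \<open>max_length R\<close> makes
  every element of \<open>R\<close> a relator of \<open>H\<close> of controlled area, and the one at
  \<open>n\<close> lets each \<open>w\<close> be written over \<open>R\<close> in the first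
  place.\<close>

lemma dehn_le_of_Rel_eq:
  assumes H: "presentation m H Y S" and G: "presentation m G X R" and "finite R"
    and L: "Rel m H Y (max_length R) = Rel m G X (max_length R)"
    and n: "Rel m H Y n = Rel m G X n"
  shows "dehn m H Y S n \<le> dehn m G X R n * dehn m H Y S (max_length R)"
proof -
  interpret F: group "free_group m" by (rule group_free_group)
  have sub: "S \<subseteq> carrier (free_group m)" "R \<subseteq> carrier (free_group m)"
    using H G by (auto simp: presentation_def)
  have "R \<subseteq> normal_closure (free_group m) R"
    by (auto simp: normal_closure_def)
  then have RelR: "r \<in> Rel m H Y (max_length R)" if "r \<in> R" for r
    using that \<open>finite R\<close> presentation_kernel_iff[OF G]
    unfolding L by (auto simp: Rel_def max_length_def)
  have "area (free_group m) S w \<le> dehn m G X R n * dehn m H Y S (max_length R)"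
    if w: "w \<in> Rel m H Y n" for w
  proof -
    have w': "w \<in> Rel m G X n" using w unfolding n .
    have "area (free_group m) S w \<le> area (free_group m) R w * dehn m H Y S (max_length R)"
    proof (rule F.area_change_relators[OF sub])
      show "R \<subseteq> normal_closure (free_group m) S"
        using RelR presentation_kernel_iff[OF H] by (auto simp: Rel_def)
      show "w \<in> normal_closure (free_group m) R"
        using w' presentation_kernel_iff[OF G] by (simp add: Rel_def)
    qed (rule area_le_dehn[OF RelR])
    \<comment> \<open>Passing from the area of \<open>w\<close> to the Dehn function of
      \<open>G\<close> makes the first factor independent of \<open>w\<close>.\<close>
    also have "\<dots> \<le> dehn m G X R n * dehn m H Y S (max_length R)"
      using area_le_dehn[OF w'] by (rule mult_right_mono) simp
    finally show ?thesis .
  qed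
  then show ?thesis
    \<comment> \<open>Bounding \<open>Max\<close> elementwise requires a nonempty finite set; the
      empty word provides an element.\<close>
    unfolding dehn_def[of m H Y S n] using finite_Rel[of m H Y n] Nil_in_Rel[of m H Y n]
    by (subst Max_le_iff) blast+
qed

theorem mainTheorem2:
  fixes m :: nat
    and Gs :: "nat \<Rightarrow> 'a monoid" and Xs :: "nat \<Rightarrow> 'a list"
    and Rs :: "nat \<Rightarrow> letter list set"
    and G :: "'b monoid" and X :: "'b list"
    and R :: "letter list set"
  assumes "m \<ge> 1"
    and "\<And>i. i \<ge> 1 \<Longrightarrow> marked_group m (Gs i) (Xs i)"
    and "marked_group m G X"
    and "(\<lambda>i. mg_dist m (Gs i) (Xs i) G X) \<longlonglongrightarrow> 0"
    and "\<And>i. i \<ge> 1 \<Longrightarrow> presentation m (Gs i) (Xs i) (Rs i)"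
    and "presentation m G X R" and "finite R"
    and "finite {dehn m (Gs i) (Xs i) (Rs i) (max_length R) | i. i \<ge> 1}"
  shows "\<forall>n. finite {dehn m (Gs i) (Xs i) (Rs i) n | i. i \<ge> 1}"
proof
  fix n
  \<comment> \<open>Agreement at this single level descends to both \<open>n\<close> and
    \<open>max_length R\<close>.\<close>
  define K where "K = max n (max_length R)"
  have "\<forall>\<^sub>F i in sequentially. mg_dist m (Gs i) (Xs i) G X < exp (- real K)"
    using assms(4) by (rule order_tendstoD) simp
  then obtain N where N: "\<And>i. i \<ge> N \<Longrightarrow> mg_dist m (Gs i) (Xs i) G X < exp (- real K)"
    by (auto simp: eventually_sequentially)
  obtain D where D: "\<And>i. i \<ge> 1 \<Longrightarrow> dehn m (Gs i) (Xs i) (Rs i) (max_length R) \<le> D"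
    using assms(8) by (auto simp: finite_nat_set_iff_bounded_le)
  have "dehn m (Gs i) (Xs i) (Rs i) n \<le> dehn m G X R n * D" if "i \<ge> 1" "i \<ge> N" for i
  proof -
    have "Rel m (Gs i) (Xs i) K = Rel m G X K"
      using N[OF that(2)] by (rule Rel_eq_of_mg_dist_less)
    then have "Rel m (Gs i) (Xs i) k = Rel m G X k" if "k \<le> K" for k
      using that by (rule Rel_eq_antimono)
    then have "dehn m (Gs i) (Xs i) (Rs i) n
        \<le> dehn m G X R n * dehn m (Gs i) (Xs i) (Rs i) (max_length R)"
      using assms(5)[OF that(1)] assms(6,7) by (intro dehn_le_of_Rel_eq) (simp_all add: K_def)
    also have "\<dots> \<le> dehn m G X R n * D" using D[OF that(1)] by simp
    finally show ?thesis .
  qed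
  \<comment> \<open>The finitely many indices below \<open>N\<close> are not controlled by
    convergence, but contribute only finitely many values; all later values lie in a bounded set of
    naturals.\<close>
  then have "{dehn m (Gs i) (Xs i) (Rs i) n | i. i \<ge> 1} \<subseteq>
      (\<lambda>i. dehn m (Gs i) (Xs i) (Rs i) n) ` {..<N} \<union> {..dehn m G X R n * D}"
    by (smt (verit) UnI1 UnI2 atMost_iff imageI lessThan_iff mem_Collect_eq not_less subsetI)
  then show "finite {dehn m (Gs i) (Xs i) (Rs i) n | i. i \<ge> 1}"
    by (rule finite_subset) simp
qed

end
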